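(* Let $k\ge 2$ and $j\ge k+1$ be integers, and let $(G_t)_{t\ge j}$ be the random graph process started from the complete graph $G_j=K_j$ on vertices $v_1,\dots,v_j$, in which $G_{t}$ is obtained from $G_{t-1}$ by adding a vertex $v_t$ that is joined to a vertex $w$ of $G_{t-1}$ chosen with probability proportional to degree, and to $k-1$ distinct neighbours of $w$ in $G_{t-1}$ chosen uniformly at random. Let $d_n(v_i)$ be the degree of $v_i$ in $G_n$ and put $R=\frac{j(j-1)}{2k}$. (1) For every $1\le i\le j$, every $n\ge j$ and every integer $0\le x\le n-j$, $$ \mathbf{P}\left(d_n(v_i)=j-1+x\right)=\binom{x+j-2}{x}\sum_{u=0}^{x}(-1)^u\binom{x}{u}\,\frac{\left[n-j+\frac{(j-1)(j-k)-ku}{2k}-1\right]_{n-j}}{\left[n-j+R-1\right]_{n-j}} . $$ (2) For every $i>j$, every $n\ge i$ and every integer $0\le x\le n-i$, $$ \mathbf{P}\left(d_n(v_i)=k+x\right)=\binom{x+k-1}{x}\sum_{u=0}^{x}(-1)^u\binom{x}{u}\,\frac{\left[n-j+R-\frac{u+k}{2}-1\right]_{n-i}}{\left[n-j+R-1\right]_{n-i}} . $$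
   Context: For a real number $y$ and an integer $m\ge 0$, $[y]_m=y(y-1)\cdots(y-m+1)$ denotes the falling factorial, with $[y]_0=1$. The process: $G_j=K_j$ has vertex set $\{v_1,\dots,v_j\}$. For $t>j$, given $G_{t-1}$ (a simple graph on $\{v_1,\dots,v_{t-1}\}$), first a vertex $w$ of $G_{t-1}$ is chosen with probability $d_{t-1}(w)/\sum_{l=1}^{t-1}d_{t-1}(v_l)$, where $d_{t-1}(\cdot)$ denotes degree in $G_{t-1}$; then a set of $k-1$ distinct neighbours of $w$ in $G_{t-1}$ is chosen uniformly at random among all such sets. The new vertex $v_t$ is joined by one edge to $w$ and by one edge to each of the $k-1$ chosen neighbours. Thus each new vertex has degree $k$ when it is added, and $G_t$ has $t$ vertices and $\frac{j(j-1)}{2}+(t-j)k$ edges. *)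

theory Defs
  imports "HOL-Probability.Probability"
begin

text \<open>Graphs are pairs of a vertex set and a set of two-element edges; the vertex \<open>v\<^sub>i\<close> is the number \<open>i\<close>.\<close>

type_synonym ugraph = "nat set \<times> nat set set"

abbreviation verts :: "ugraph \<Rightarrow> nat set" where
  "verts G \<equiv> fst G"

abbreviation edges :: "ugraph \<Rightarrow> nat set set" where
  "edges G \<equiv> snd G"

definition nbrs :: "ugraph \<Rightarrow> nat \<Rightarrow> nat set" where
  "nbrs G v = {u \<in> verts G. {u, v} \<in> edges G}"

definition deg :: "ugraph \<Rightarrow> nat \<Rightarrow> nat" where
  "deg G v = card (nbrs G v)"

definition complete_ugraph :: "nat \<Rightarrow> ugraph" where
  "complete_ugraph j = ({1..j}, {e. e \<subseteq> {1..j} \<and> card e = 2})"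

definition falling :: "real \<Rightarrow> nat \<Rightarrow> real" where
  "falling y m = (\<Prod>r<m. y - real r)"

definition degree_pmf :: "ugraph \<Rightarrow> nat pmf" where
  "degree_pmf G = embed_pmf (\<lambda>w.
     if w \<in> verts G then real (deg G w) / (\<Sum>v\<in>verts G. real (deg G v)) else 0)"

text \<open>\<open>embed_pmf\<close> is meaningful only for functions of total mass one; this is the case here as
  soon as the graph is finite and has an edge.\<close>

lemma pmf_degree_pmf:
  assumes fin: "finite (verts G)" and pos: "(\<Sum>v\<in>verts G. real (deg G v)) > 0"
  shows "pmf (degree_pmf G) w =
    (if w \<in> verts G then real (deg G w) / (\<Sum>v\<in>verts G. real (deg G v)) else 0)"
proof -
  let ?f = "\<lambda>w. if w \<in> verts G
    then real (deg G w) / (\<Sum>v\<in>verts G. real (deg G v)) else 0"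
  have nonneg: "?f x \<ge> 0" for x
    by (auto intro!: divide_nonneg_nonneg sum_nonneg)
  have "(\<integral>\<^sup>+x. ennreal (?f x) \<partial>count_space UNIV) = (\<Sum>x\<in>verts G. ennreal (?f x))"
    by (rule nn_integral_count_space'[OF fin]) auto
  also have "\<dots> = ennreal (\<Sum>x\<in>verts G. ?f x)"
    by (intro sum_ennreal nonneg)
  also have "(\<Sum>x\<in>verts G. ?f x) = 1"
    using pos by (simp flip: sum_divide_distrib)
  finally show ?thesis
    unfolding degree_pmf_def by (intro pmf_embed_pmf nonneg) simp
qed

definition attach :: "nat \<Rightarrow> nat \<Rightarrow> ugraph \<Rightarrow> ugraph pmf" where
  "attach k t G = do {
     w \<leftarrow> degree_pmf G;
     S \<leftarrow> pmf_of_set {S. S \<subseteq> nbrs G w \<and> card S = k - 1};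
     return_pmf (insert t (verts G), edges G \<union> (\<lambda>u. {u, t}) ` insert w S)
   }"

text \<open>The law of \<open>G\<^sub>n\<close> for \<open>n \<ge> j\<close>. The values for \<open>n < j\<close> are dummies: the process starts at time \<open>j\<close>.\<close>

primrec graph_process :: "nat \<Rightarrow> nat \<Rightarrow> nat \<Rightarrow> ugraph pmf" where
  "graph_process k j 0 = return_pmf (complete_ugraph j)"
| "graph_process k j (Suc n) =
     (if Suc n \<le> j then return_pmf (complete_ugraph j)
      else graph_process k j n \<bind> attach k (Suc n))"

text \<open>All graphs that occur are simple and have minimum degree at least \<open>k\<close>, so the degree distribution
  is proper and \<open>pmf_of_set\<close> is only applied to finite nonempty sets.\<close>

lemma graph_process_invariant:
  assumes "k \<ge> 2" and "j \<ge> k + 1" and "n \<ge> j" and "G \<in> set_pmf (graph_process k j n)"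
  shows "verts G = {1..n} \<and> (\<forall>e\<in>edges G. e \<subseteq> {1..n} \<and> card e = 2) \<and> (\<forall>v\<in>{1..n}. deg G v \<ge> k)"
  using assms(3,4)
proof (induction n arbitrary: G rule: dec_induct)
  case base
  have G: "G = complete_ugraph j"
    using base assms by (cases j) auto
  have nb: "nbrs G v = {1..j} - {v}" if "v \<in> {1..j}" for v
  proof -
    have "card {u, v} = 2 \<longleftrightarrow> u \<noteq> v" for u
      by (cases "u = v") simp_all
    then show ?thesis
      using that by (simp add: nbrs_def G complete_ugraph_def set_eq_iff) blast
  qed
  then have "deg G v = j - 1" if "v \<in> {1..j}" for v
    unfolding deg_def nb[OF that] using that by (subst card_Diff_singleton) auto
  then show ?case
    using assms by (auto simp: G complete_ugraph_def)
next
  case (step n)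
  from step.prems step.hyps obtain H w S where H: "H \<in> set_pmf (graph_process k j n)"
    and w: "w \<in> set_pmf (degree_pmf H)"
    and S: "S \<in> set_pmf (pmf_of_set {S. S \<subseteq> nbrs H w \<and> card S = k - 1})"
    and G: "G = (insert (Suc n) (verts H), edges H \<union> (\<lambda>u. {u, Suc n}) ` insert w S)"
    by (auto simp: attach_def)
  note IH = step.IH[OF H]
  have V: "verts H = {1..n}" and degH: "\<And>v. v \<in> {1..n} \<Longrightarrow> deg H v \<ge> k"
    and E: "\<And>e. e \<in> edges H \<Longrightarrow> e \<subseteq> {1..n} \<and> card e = 2"
    using IH by auto
  have "n \<ge> 1" using assms step.hyps by auto
  have "(\<Sum>v\<in>verts H. real (deg H v)) > 0"
  proof (rule sum_pos)
    show "real (deg H v) > 0" if "v \<in> verts H" for v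
      using degH[of v] that V assms by simp
  qed (use V \<open>n \<ge> 1\<close> in auto)
  moreover have "finite (verts H)" by (simp add: V)
  moreover have "pmf (degree_pmf H) w \<noteq> 0" using w by (simp only: set_pmf_iff not_False_eq_True)
  ultimately have "w \<in> verts H"
    using pmf_degree_pmf[of H w] by (cases "w \<in> verts H") simp_all
  then have wV: "w \<in> {1..n}" by (simp only: V)
  have sub: "nbrs H w \<subseteq> {1..n}"
    unfolding nbrs_def V by blast
  then have fin: "finite (nbrs H w)"
    by (rule finite_subset) simp
  have "k - 1 \<le> card (nbrs H w)"
    using degH[OF wV] by (simp add: deg_def)
  then obtain T where "T \<subseteq> nbrs H w" "card T = k - 1"
    by (rule obtain_subset_with_card_n)
  then have ne: "{S. S \<subseteq> nbrs H w \<and> card S = k - 1} \<noteq> {}" by auto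
  have "finite {S. S \<subseteq> nbrs H w \<and> card S = k - 1}"
    using fin by simp
  from S[unfolded set_pmf_of_set[OF ne this]]
  have S': "S \<subseteq> nbrs H w" "card S = k - 1" by simp_all
  have "w \<notin> nbrs H w"
    using E[of "{w}"] by (auto simp: nbrs_def)
  then have card_S: "card (insert w S) = k"
    using S' finite_subset[OF S'(1) fin] assms(1) by (subst card_insert_disjoint) auto
  have sub': "insert w S \<subseteq> {1..n}"
    using S' sub wV by auto
  have vG: "verts G = {1..Suc n}"
    using V by (auto simp: G)
  have eG: "e \<subseteq> {1..Suc n} \<and> card e = 2" if "e \<in> edges G" for e
  proof (cases "e \<in> edges H")
    case True
    then have "e \<subseteq> {1..n}" "card e = 2" by (simp_all only: E)
    moreover have "{1..n} \<subseteq> {1..Suc n}" by auto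
    ultimately show ?thesis by blast
  next
    case False
    then obtain u where "u \<in> insert w S" "e = {u, Suc n}"
      using \<open>e \<in> edges G\<close> by (auto simp: G)
    moreover from this have "u \<in> {1..n}" using sub' by blast
    ultimately show ?thesis by simp
  qed
  have dG: "deg G v \<ge> k" if "v \<in> {1..Suc n}" for v
  proof (cases "v = Suc n")
    case True
    have "insert w S \<subseteq> nbrs G v"
      using sub' by (auto simp: nbrs_def True G V)
    moreover have "finite (nbrs G v)" by (simp add: nbrs_def vG)
    ultimately have "card (insert w S) \<le> deg G v"
      unfolding deg_def by (intro card_mono)
    then show ?thesis by (simp only: card_S)
  next
    case False
    have "nbrs H v \<subseteq> nbrs G v" by (auto simp: nbrs_def G)
    moreover have "finite (nbrs G v)" by (simp add: nbrs_def vG)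
    ultimately have "deg H v \<le> deg G v" unfolding deg_def by (intro card_mono)
    then show ?thesis using degH[of v] that False by auto
  qed
  show ?case using vG eG dG by blast
qed

end

theory Submission imports Defs begin

text \<open>Given \<open>G\<^sub>n\<close>, a vertex of degree \<open>d\<close> gains an edge with probability
  \<open>k d / (total degree)\<close>, which depends on \<open>d\<close> and \<open>n\<close> only. Hence its degree is a
  time-inhomogeneous pure birth chain, and the claimed formula, extended to all \<open>x\<close>, satisfies the
  one-step recurrence of this chain.\<close>

section \<open>One attachment step\<close>

text \<open>Counting the complement: the \<open>m\<close>-subsets avoiding \<open>v\<close> are
  exactly those of \<open>N - {v}\<close>, and the absorption identity
  \<open>(n - m) * (n choose m) = n * ((n - 1) choose m)\<close> reduces the quotient to
  \<open>m / n\<close>.\<close>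

lemma prob_random_subset_contains:
  assumes "finite N" and "m \<le> card N" and "v \<in> N"
  shows "measure_pmf.prob (pmf_of_set {S. S \<subseteq> N \<and> card S = m}) {S. v \<in> S} = real m / real (card N)"
proof -
  let ?F = "{S. S \<subseteq> N \<and> card S = m}" and ?A = "{S. S \<subseteq> N - {v} \<and> card S = m}"
  have cF: "card ?F = card N choose m"
    by (rule n_subsets[OF assms(1)])
  have cA: "card ?A = (card N - 1) choose m"
    using n_subsets[of "N - {v}" m] assms by simp
  have fF: "finite ?F"
    using assms(1) by simp
  have pos: "card N choose m > 0" and N: "card N > 0"
    using assms by (auto simp: card_gt_0_iff)
  then have ne: "?F \<noteq> {}"
    using cF by (metis card.empty less_irrefl)
  have "?F \<inter> {S. v \<in> S} = ?F - ?A"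
    by blast
  moreover have "?A \<subseteq> ?F"
    by blast
  ultimately have "card (?F \<inter> {S. v \<in> S}) = (card N choose m) - ((card N - 1) choose m)"
    using fF cF cA by (simp add: card_Diff_subset finite_subset)
  moreover have "(card N - 1) choose m \<le> card N choose m"
    by (rule binomial_right_mono) simp
  moreover have "(real (card N) - real m) * real (card N choose m)
      = real (card N) * real ((card N - 1) choose m)"
    using binomial_absorb_comp[of "card N" m] assms(2)
    by (metis of_nat_diff of_nat_mult)
  ultimately show ?thesis
    using pos N by (simp add: measure_pmf_of_set[OF ne fF] cF of_nat_diff field_simps)
qed

text \<open>All randomness of a step sits in the set of vertices that the new vertex is joined to;
  the rest is the deterministic map \<open>add_vertex\<close>. Events about new degrees thereby
  become events about membership in this set.\<close>

definition targets :: "nat \<Rightarrow> ugraph \<Rightarrow> nat set pmf" where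
  "targets k G = do {
     w \<leftarrow> degree_pmf G;
     S \<leftarrow> pmf_of_set {S. S \<subseteq> nbrs G w \<and> card S = k - 1};
     return_pmf (insert w S)
   }"

definition add_vertex :: "nat \<Rightarrow> ugraph \<Rightarrow> nat set \<Rightarrow> ugraph" where
  "add_vertex t G A = (insert t (verts G), edges G \<union> (\<lambda>u. {u, t}) ` A)"

lemma attach_eq_map_targets: "attach k t G = map_pmf (add_vertex t G) (targets k G)"
  by (simp add: attach_def targets_def add_vertex_def map_bind_pmf)

text \<open>The disjunct \<open>{t, v} \<in> edges G\<close> covers edge sets that mention
  \<open>t\<close> although \<open>t\<close> is not yet a vertex; simplicity of the graph excludes
  this in \<open>deg_add_vertex\<close>.\<close>

lemma nbrs_add_vertex:
  assumes "v \<in> verts G" and "t \<notin> verts G"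
  shows "nbrs (add_vertex t G A) v =
    nbrs G v \<union> (if v \<in> A \<or> {t, v} \<in> edges G then {t} else {})"
  using assms by (auto simp: nbrs_def add_vertex_def doubleton_eq_iff)

lemma nbrs_add_vertex_new:
  assumes "A \<subseteq> verts G" and "t \<notin> verts G" and "\<And>e. e \<in> edges G \<Longrightarrow> t \<notin> e"
  shows "nbrs (add_vertex t G A) t = A"
  using assms by (auto simp: nbrs_def add_vertex_def doubleton_eq_iff)

lemma nbrs_sym: "u \<in> verts G \<Longrightarrow> v \<in> nbrs G u \<Longrightarrow> u \<in> nbrs G v"
  by (simp add: nbrs_def insert_commute)

text \<open>The share of \<open>graph_process_invariant\<close> that a single step relies on.
  Minimum degree \<open>k\<close> guarantees \<open>k - 1\<close> neighbours to choose from and a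
  positive total degree.\<close>

locale min_degree_graph =
  fixes k :: nat and G :: ugraph
  assumes finite_verts: "finite (verts G)"
    and verts_nonempty: "verts G \<noteq> {}"
    and edges_simple: "\<And>e. e \<in> edges G \<Longrightarrow> e \<subseteq> verts G \<and> card e = 2"
    and k_pos: "k \<ge> 1"
    and min_degree: "\<And>v. v \<in> verts G \<Longrightarrow> k \<le> deg G v"
begin

abbreviation "total_degree \<equiv> \<Sum>v\<in>verts G. real (deg G v)"

lemma nbrs_subset: "nbrs G v \<subseteq> verts G"
  by (auto simp: nbrs_def)

lemma finite_nbrs: "finite (nbrs G v)"
  using finite_subset[OF nbrs_subset finite_verts] .

lemma not_self_nbr: "v \<notin> nbrs G v"
  using edges_simple[of "{v}"] by (auto simp: nbrs_def)

lemma deg_pos: "v \<in> verts G \<Longrightarrow> deg G v > 0"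
  using min_degree[of v] k_pos by simp

lemma total_degree_pos: "total_degree > 0"
  using finite_verts verts_nonempty deg_pos by (intro sum_pos) auto

lemma pmf_degree:
  "pmf (degree_pmf G) w = (if w \<in> verts G then real (deg G w) / total_degree else 0)"
  by (rule pmf_degree_pmf[OF finite_verts total_degree_pos])

lemma set_degree_pmf: "w \<in> set_pmf (degree_pmf G) \<Longrightarrow> w \<in> verts G"
  unfolding set_pmf_iff pmf_degree by (simp split: if_splits)

lemma subsets_finite_nonempty:
  assumes "w \<in> verts G"
  shows "finite {S. S \<subseteq> nbrs G w \<and> card S = k - 1}" "{S. S \<subseteq> nbrs G w \<and> card S = k - 1} \<noteq> {}"
proof -
  show "finite {S. S \<subseteq> nbrs G w \<and> card S = k - 1}"
    using finite_nbrs by simp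
  have "k - 1 \<le> card (nbrs G w)"
    using min_degree[OF assms] by (simp add: deg_def)
  then obtain T where "T \<subseteq> nbrs G w" "card T = k - 1"
    by (rule obtain_subset_with_card_n)
  then show "{S. S \<subseteq> nbrs G w \<and> card S = k - 1} \<noteq> {}"
    by auto
qed

text \<open>No vertex is its own neighbour, so \<open>w\<close> adds one element to the
  \<open>k - 1\<close> chosen neighbours.\<close>

lemma set_targets:
  assumes "A \<in> set_pmf (targets k G)"
  shows "A \<subseteq> verts G \<and> card A = k"
proof -
  obtain w S where w: "w \<in> set_pmf (degree_pmf G)" and A: "A = insert w S"
    and S: "S \<in> set_pmf (pmf_of_set {S. S \<subseteq> nbrs G w \<and> card S = k - 1})"
    using assms by (auto simp: targets_def)
  have wV: "w \<in> verts G"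
    by (rule set_degree_pmf[OF w])
  have S': "S \<subseteq> nbrs G w" "card S = k - 1"
    using S subsets_finite_nonempty[OF wV] by (simp_all add: set_pmf_of_set)
  have "finite S"
    using S'(1) finite_nbrs by (rule finite_subset)
  moreover have "w \<notin> S"
    using S'(1) not_self_nbr[of w] by blast
  ultimately show ?thesis
    using S' A wV nbrs_subset k_pos by auto
qed

text \<open>The degree-proportional choice of \<open>w\<close> cancels the factor \<open>1 / deg w\<close> from the uniform
  choice among the neighbours of \<open>w\<close>, so every neighbour of \<open>v\<close> contributes equally.\<close>

lemma prob_target:
  assumes v: "v \<in> verts G"
  shows "measure_pmf.prob (targets k G) {A. v \<in> A} = real k * real (deg G v) / total_degree"
proof -
  define U where "U w = pmf_of_set {S. S \<subseteq> nbrs G w \<and> card S = k - 1}" for w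
  let ?c = "(real k - 1) / total_degree"
  have prob_U: "measure_pmf.prob (U w) {S. v \<in> insert w S} =
      (if w = v then 1 else if w \<in> nbrs G v then (real k - 1) / real (deg G w) else 0)"
    if w: "w \<in> verts G" for w
  proof -
    consider (eq) "w = v" | (nbr) "w \<noteq> v" "w \<in> nbrs G v" | (far) "w \<noteq> v" "w \<notin> nbrs G v"
      by argo
    then show ?thesis
    proof cases
      case eq
      then show ?thesis
        by simp
    next
      case nbr
      have vw: "v \<in> nbrs G w"
        by (rule nbrs_sym[OF v nbr(2)])
      have "k - 1 \<le> card (nbrs G w)"
        using min_degree[OF w] by (simp add: deg_def)
      from prob_random_subset_contains[OF finite_nbrs this vw] show ?thesis
        using nbr k_pos by (simp add: U_def deg_def of_nat_diff)
    next
      case far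
      have "v \<notin> nbrs G w"
        using far(2) nbrs_sym[OF w] by metis
      then have disj: "{S. S \<subseteq> nbrs G w \<and> card S = k - 1} \<inter> {S. v \<in> S} = {}"
        by blast
      have "measure_pmf.prob (U w) {S. v \<in> S} = 0"
        unfolding U_def measure_pmf_of_set[OF subsets_finite_nonempty(2,1)[OF w]] disj by simp
      then show ?thesis
        using far by simp
    qed
  qed
  \<comment> \<open>Writing the event as the value \<open>True\<close> of a Boolean random variable
    lets \<open>pmf_bind\<close> condition on \<open>w\<close>.\<close>
  have "measure_pmf.prob (targets k G) {A. v \<in> A} = pmf (map_pmf (\<lambda>A. v \<in> A) (targets k G)) True"
    by (simp add: pmf_map vimage_def)
  also have "map_pmf (\<lambda>A. v \<in> A) (targets k G) =
      degree_pmf G \<bind> (\<lambda>w. map_pmf (\<lambda>S. v \<in> insert w S) (U w))"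
    by (simp only: targets_def U_def map_pmf_def bind_assoc_pmf bind_return_pmf)
  also have "pmf \<dots> True = (\<integral>w. measure_pmf.prob (U w) {S. v \<in> insert w S} \<partial>degree_pmf G)"
    by (simp add: pmf_bind pmf_map vimage_def)
  also have "\<dots> = (\<Sum>w\<in>verts G. pmf (degree_pmf G) w * measure_pmf.prob (U w) {S. v \<in> insert w S})"
    by (subst integral_measure_pmf[OF finite_verts]) (auto dest: set_degree_pmf)
  \<comment> \<open>For a neighbour \<open>w\<close> of \<open>v\<close>, the product of
    \<open>deg G w / total_degree\<close> and \<open>(k - 1) / deg G w\<close> is the constant
    \<open>?c\<close>. As \<open>v\<close> is not its own neighbour, the two cases never
    overlap.\<close>
  also have "\<dots> = (\<Sum>w\<in>verts G. (if w = v then real (deg G v) / total_degree else 0)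
      + (if w \<in> nbrs G v then ?c else 0))"
    using deg_pos not_self_nbr by (intro sum.cong refl) (simp add: prob_U pmf_degree del: insert_iff)
  also have "\<dots> = real (deg G v) / total_degree + real (deg G v) * ?c"
    using v finite_verts nbrs_subset[of v]
    by (simp add: sum.distrib sum.If_cases deg_def Int_absorb1 Int_commute)
  also have "\<dots> = real k * real (deg G v) / total_degree"
    by (simp add: algebra_simps flip: add_divide_distrib)
  finally show ?thesis .
qed

lemma deg_add_vertex:
  assumes "v \<in> verts G" and "t \<notin> verts G"
  shows "deg (add_vertex t G A) v = deg G v + (if v \<in> A then 1 else 0)"
proof -
  have "{t, v} \<notin> edges G" "t \<notin> nbrs G v"
    using assms edges_simple nbrs_subset by blast+
  then show ?thesis
    using assms finite_nbrs[of v] by (simp add: deg_def nbrs_add_vertex)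
qed

lemma deg_add_vertex_new:
  assumes "A \<subseteq> verts G" and "t \<notin> verts G"
  shows "deg (add_vertex t G A) t = card A"
  using assms edges_simple by (subst deg_def, subst nbrs_add_vertex_new) auto

text \<open>The new vertex contributes \<open>card A\<close>, and each member of \<open>A\<close>
  gains one. This is what makes the total degree of the process deterministic.\<close>

lemma sum_deg_add_vertex:
  assumes "A \<subseteq> verts G" and "t \<notin> verts G"
  shows "(\<Sum>v\<in>verts (add_vertex t G A). deg (add_vertex t G A) v) =
    (\<Sum>v\<in>verts G. deg G v) + 2 * card A"
proof -
  have "(\<Sum>v\<in>verts (add_vertex t G A). deg (add_vertex t G A) v) =
      card A + (\<Sum>v\<in>verts G. deg G v + (if v \<in> A then 1 else 0))"
    using assms finite_verts
    \<comment> \<open>Only the vertex set is unfolded; \<open>add_vertex\<close> stays folded inside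
      \<open>deg\<close>, so that the degree lemmas still match.\<close>
    by (simp add: add_vertex_def[of t G A, THEN arg_cong[where f = fst]] deg_add_vertex
        deg_add_vertex_new cong: sum.cong)
  then show ?thesis
    using assms finite_verts by (simp add: sum.distrib sum.If_cases Int_absorb1)
qed

text \<open>A vertex gains at most one edge, so degree \<open>Suc d\<close> arises from
  \<open>Suc d\<close> by a miss or from \<open>d\<close> by a hit. The indicator form is linear in
  the two events and can be integrated over the random graph.\<close>

lemma prob_attach_deg_Suc:
  assumes v: "v \<in> verts G" and t: "t \<notin> verts G"
  shows "measure_pmf.prob (attach k t G) {H. deg H v = Suc d} =
    (1 - real k * real (Suc d) / total_degree) * indicator {H. deg H v = Suc d} G
    + real k * real d / total_degree * indicator {H. deg H v = d} G"
proof -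
  have "measure_pmf.prob (targets k G) {A. v \<notin> A} = 1 - real k * real (deg G v) / total_degree"
    using measure_pmf.prob_compl[of "{A. v \<in> A}" "targets k G"] prob_target[OF v]
    by (simp add: Compl_eq_Diff_UNIV[symmetric] Collect_neg_eq[symmetric])
  moreover have "measure_pmf.prob (attach k t G) {H. deg H v = Suc d} =
      measure_pmf.prob (targets k G) {A. deg G v + (if v \<in> A then 1 else 0) = Suc d}"
    by (simp add: attach_eq_map_targets vimage_def deg_add_vertex[OF v t])
  moreover have "{A. deg G v + (if v \<in> A then 1 else 0) = Suc d} =
      (if deg G v = Suc d then {A. v \<notin> A} else if deg G v = d then {A. v \<in> A} else {})"
    by auto
  ultimately show ?thesis
    using prob_target[OF v] by (simp split: split_indicator)
qed

end

section \<open>The degree of a fixed vertex\<close>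

lemma graph_process_init [simp]: "graph_process k j j = return_pmf (complete_ugraph j)"
  by (cases j) auto

lemma deg_complete_ugraph:
  assumes "v \<in> {1..j}"
  shows "deg (complete_ugraph j) v = j - 1"
proof -
  have "card {u, v} = 2 \<longleftrightarrow> u \<noteq> v" for u
    by (cases "u = v") simp_all
  then have "nbrs (complete_ugraph j) v = {1..j} - {v}"
    using assms by (simp add: nbrs_def complete_ugraph_def set_eq_iff) blast
  then show ?thesis
    using assms by (simp add: deg_def)
qed

context
  fixes k j :: nat
  assumes k: "k \<ge> 2" and j: "j \<ge> k + 1"
begin

lemma graph_process_verts:
  "j \<le> n \<Longrightarrow> G \<in> set_pmf (graph_process k j n) \<Longrightarrow> verts G = {1..n}"
  using graph_process_invariant[OF k j] by blast

lemma graph_process_min_degree: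
  assumes "j \<le> n" and "G \<in> set_pmf (graph_process k j n)"
  shows "min_degree_graph k G"
  using graph_process_invariant[OF k j assms] assms(1) k j by unfold_locales auto

text \<open>The total is the same for every graph in the support, so the transition probabilities
  depend on the current degree and the time alone.\<close>

lemma graph_process_total_degree:
  assumes "j \<le> n" and "G \<in> set_pmf (graph_process k j n)"
  shows "(\<Sum>v\<in>verts G. deg G v) = j * (j - 1) + 2 * k * (n - j)"
  using assms
proof (induction n arbitrary: G rule: dec_induct)
  case base
  then have G: "G = complete_ugraph j"
    by simp
  then have "verts G = {1..j}"
    by (simp add: complete_ugraph_def)
  then show ?case
    by (simp add: G deg_complete_ugraph)
next
  case (step n)
  then obtain H A where H: "H \<in> set_pmf (graph_process k j n)"
    and A: "A \<in> set_pmf (targets k H)" and G: "G = add_vertex (Suc n) H A"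
    by (auto simp: attach_eq_map_targets)
  interpret min_degree_graph k H
    using graph_process_min_degree[OF step.hyps(1) H] .
  have "(\<Sum>v\<in>verts G. deg G v) = (\<Sum>v\<in>verts H. deg H v) + 2 * k"
    using sum_deg_add_vertex[of A "Suc n"] set_targets[OF A] graph_process_verts[OF step.hyps(1) H]
    by (simp add: G)
  then show ?case
    using step.IH[OF H] step.hyps by (simp add: Suc_diff_le)
qed

lemma graph_process_deg_new:
  assumes "j < i" and "G \<in> set_pmf (graph_process k j i)"
  shows "deg G i = k"
proof -
  obtain n where n: "i = Suc n" "j \<le> n"
    using assms(1) by (cases i) auto
  then obtain H A where H: "H \<in> set_pmf (graph_process k j n)"
    and A: "A \<in> set_pmf (targets k H)" and G: "G = add_vertex (Suc n) H A"
    using assms by (auto simp: attach_eq_map_targets)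
  interpret min_degree_graph k H
    using graph_process_min_degree[OF n(2) H] .
  show ?thesis
    using deg_add_vertex_new[of A "Suc n"] set_targets[OF A] graph_process_verts[OF n(2) H]
    by (simp add: G n)
qed

text \<open>The boundary value for the recurrence below, which only speaks of degrees of the form
  \<open>Suc d\<close>.\<close>

lemma prob_deg_0:
  assumes "1 \<le> i" and "i \<le> n" and "j \<le> n"
  shows "measure_pmf.prob (graph_process k j n) {G. deg G i = 0} = 0"
proof -
  have "k \<le> deg G i" if "G \<in> set_pmf (graph_process k j n)" for G
    using graph_process_invariant[OF k j assms(3) that] assms(1,2) atLeastAtMost_iff by blast
  then have "set_pmf (graph_process k j n) \<inter> {G. deg G i = 0} = {}"
    using k by fastforce
  then show ?thesis
    by (simp only: measure_pmf_zero_iff)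
qed

text \<open>The total degree at time \<open>n\<close> is \<open>2 * k * T\<close>, so the factor
  \<open>k\<close> cancels from the probability \<open>k * d / total_degree\<close> of gaining an
  edge.\<close>

lemma prob_deg_recurrence:
  assumes i: "1 \<le> i" "i \<le> n" and n: "j \<le> n"
    and T: "T = real j * (real j - 1) / (2 * real k) + real n - real j"
  shows "measure_pmf.prob (graph_process k j (Suc n)) {G. deg G i = Suc d} =
    (1 - real (Suc d) / (2 * T)) * measure_pmf.prob (graph_process k j n) {G. deg G i = Suc d}
    + real d / (2 * T) * measure_pmf.prob (graph_process k j n) {G. deg G i = d}"
proof -
  let ?P = "graph_process k j n"
  have step: "measure_pmf.prob (attach k (Suc n) G) {H. deg H i = Suc d} =
      (1 - real (Suc d) / (2 * T)) * indicator {H. deg H i = Suc d} G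
      + real d / (2 * T) * indicator {H. deg H i = d} G"
    if G: "G \<in> set_pmf ?P" for G
  proof -
    interpret min_degree_graph k G
      using graph_process_min_degree[OF n G] .
    have "total_degree = real (j * (j - 1) + 2 * k * (n - j))"
      using graph_process_total_degree[OF n G] by (metis of_nat_sum)
    also have "\<dots> = k * (2 * T)"
      using k j n by (simp add: T of_nat_diff field_simps)
    finally have D: "total_degree = k * (2 * T)" .
    show ?thesis
      using prob_attach_deg_Suc[of i "Suc n" d] graph_process_verts[OF n G] i k
      unfolding D by simp
  qed
  have "measure_pmf.prob (graph_process k j (Suc n)) {G. deg G i = Suc d} =
      pmf (map_pmf (\<lambda>H. deg H i) (?P \<bind> attach k (Suc n))) (Suc d)"
    using n by (simp add: pmf_map vimage_def)
  also have "\<dots> = (\<integral>G. measure_pmf.prob (attach k (Suc n) G) {H. deg H i = Suc d} \<partial>?P)"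
    by (simp add: map_bind_pmf pmf_bind pmf_map vimage_def)
  \<comment> \<open>The one-step formula is known only on the support of \<open>?P\<close>, hence
    the almost-everywhere congruence.\<close>
  also have "\<dots> = (\<integral>G. (1 - real (Suc d) / (2 * T)) * indicator {H. deg H i = Suc d} G
      + real d / (2 * T) * indicator {H. deg H i = d} G \<partial>?P)"
    using step by (intro integral_cong_AE) (simp_all add: AE_measure_pmf_iff)
  also have "\<dots> = (1 - real (Suc d) / (2 * T)) * measure_pmf.prob ?P {G. deg G i = Suc d}
      + real d / (2 * T) * measure_pmf.prob ?P {G. deg G i = d}"
    by (subst Bochner_Integration.integral_add)
      (auto intro!: integrable_mult_right integrable_real_indicator simp: measure_pmf.emeasure_finite less_top[symmetric])
  finally show ?thesis .
qed

end

section \<open>Solving the recurrence\<close>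

text \<open>Splits off the top factor: one further time step raises both the argument and the length
  of the factorials in \<open>degree_law\<close>.\<close>

lemma falling_Suc_shift: "falling (y + 1) (Suc m) = (y + 1) * falling y m"
  unfolding falling_def by (subst prod.lessThan_Suc_shift) (simp add: algebra_simps)

text \<open>With \<open>B = R + (time of birth) - j\<close>, this is the probability that a vertex born with
  degree \<open>d\<close> has degree \<open>d + x\<close> after \<open>s\<close> further steps.\<close>

definition degree_law :: "nat \<Rightarrow> real \<Rightarrow> nat \<Rightarrow> nat \<Rightarrow> real" where
  "degree_law d B s x = real ((x + d - 1) choose x) *
     (\<Sum>u = 0..x. (-1) ^ u * real (x choose u) *
       (falling (B + real s - (real u + real d) / 2 - 1) s / falling (B + real s - 1) s))"

text \<open>Empty falling factorials equal 1, leaving the alternating binomial sum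
  \<open>(1 - 1) ^ x\<close>.\<close>

lemma degree_law_0: "degree_law d B 0 x = (if x = 0 then 1 else 0)"
  using choose_alternating_sum[of x, where 'a = real]
  by (cases "x = 0") (simp_all add: degree_law_def falling_def atLeast0AtMost)

text \<open>Numerator and denominator each gain one top factor. With \<open>c = (u + d) / 2\<close>,
  each summand of \<open>degree_law\<close> thus evolves by its own scalar factor.\<close>

lemma falling_ratio_Suc:
  assumes "B > 0"
  shows "falling (B + real (Suc s) - c - 1) (Suc s) / falling (B + real (Suc s) - 1) (Suc s) =
    (1 - c / (B + real s)) * (falling (B + real s - c - 1) s / falling (B + real s - 1) s)"
proof -
  have "falling (B + real (Suc s) - c - 1) (Suc s) = (B + real s - c) * falling (B + real s - c - 1) s"
    using falling_Suc_shift[of "B + real s - c - 1" s] by (simp add: algebra_simps)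
  moreover have "falling (B + real (Suc s) - 1) (Suc s) = (B + real s) * falling (B + real s - 1) s"
    using falling_Suc_shift[of "B + real s - 1" s] by (simp add: algebra_simps)
  moreover have "B + real s > 0"
    using assms by simp
  ultimately show ?thesis
    by (simp add: diff_divide_distrib[symmetric] divide_simps)
qed

lemma degree_law_Suc_0:
  assumes "B > 0"
  shows "degree_law d B (Suc s) 0 = (1 - real d / (2 * (B + real s))) * degree_law d B s 0"
  using falling_ratio_Suc[OF assms, of s "real d / 2"] by (simp add: degree_law_def)

text \<open>Term \<open>u\<close> is multiplied by \<open>1 - (u + d) / T\<close>, which splits as
  \<open>(1 - (d + Suc x) / T) + (Suc x - u) / T\<close>. The first part gives the law at
  \<open>Suc x\<close>; in the second, \<open>absorb\<close> lowers the inner binomial and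
  \<open>absorb'\<close> the outer one, giving the law at \<open>x\<close>.\<close>

lemma degree_law_Suc_Suc:
  assumes B: "B > 0" and d: "d \<ge> 1"
  shows "degree_law d B (Suc s) (Suc x) =
    (1 - real (d + Suc x) / (2 * (B + real s))) * degree_law d B s (Suc x)
    + real (d + x) / (2 * (B + real s)) * degree_law d B s x"
proof -
  define T where "T = 2 * (B + real s)"
  define a where "a u = falling (B + real s - (real u + real d) / 2 - 1) s / falling (B + real s - 1) s"
    for u :: nat
  have a_Suc: "falling (B + real (Suc s) - (real u + real d) / 2 - 1) (Suc s)
      / falling (B + real (Suc s) - 1) (Suc s) = (1 - (real u + real d) / T) * a u" for u
    using falling_ratio_Suc[OF B, of s "(real u + real d) / 2"] by (simp add: a_def T_def)
  have absorb: "real (Suc x choose u) * (real (Suc x) - real u) = real (Suc x) * real (x choose u)"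
    if "u \<le> Suc x" for u
    using binomial_absorb_comp[of "Suc x" u] that
    by (metis diff_Suc_1 mult.commute of_nat_diff of_nat_mult)
  have absorb': "real (Suc x) * real ((Suc x + d - 1) choose Suc x)
      = real (d + x) * real ((x + d - 1) choose x)"
  proof -
    have "Suc (x + d - 1) * ((x + d - 1) choose x) = (Suc (x + d - 1) choose Suc x) * Suc x"
      by (rule Suc_times_binomial_eq)
    \<comment> \<open>The truncated subtraction is harmless because
      \<open>d \<ge> 1\<close>.\<close>
    moreover have "Suc (x + d - 1) = d + x" "Suc x + d - 1 = d + x"
      using d by simp_all
    ultimately show ?thesis
      by (metis mult.commute of_nat_mult)
  qed
  let ?S = "\<lambda>x. \<Sum>u = 0..x. (-1) ^ u * real (x choose u) * a u"
  have "(\<Sum>u = 0..Suc x. (-1) ^ u * real (Suc x choose u) * ((1 - (real u + real d) / T) * a u)) =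
      (\<Sum>u = 0..Suc x. (1 - real (d + Suc x) / T) * ((-1) ^ u * real (Suc x choose u) * a u)
        + real (Suc x) / T * ((-1) ^ u * real (x choose u) * a u))"
  proof (intro sum.cong refl)
    fix u assume "u \<in> {0..Suc x}"
    then have u: "u \<le> Suc x"
      by simp
    have "(-1) ^ u * real (Suc x choose u) * ((1 - (real u + real d) / T) * a u) =
        (1 - real (d + Suc x) / T) * ((-1) ^ u * real (Suc x choose u) * a u)
        + (real (Suc x choose u) * (real (Suc x) - real u)) / T * ((-1) ^ u * a u)"
      by (simp add: algebra_simps add_divide_distrib diff_divide_distrib)
    then show "(-1) ^ u * real (Suc x choose u) * ((1 - (real u + real d) / T) * a u) =
        (1 - real (d + Suc x) / T) * ((-1) ^ u * real (Suc x choose u) * a u)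
        + real (Suc x) / T * ((-1) ^ u * real (x choose u) * a u)"
      unfolding absorb[OF u] by simp
  qed
  \<comment> \<open>In the second sum the term \<open>u = Suc x\<close> vanishes, since
    \<open>x choose Suc x = 0\<close>.\<close>
  also have "\<dots> = (1 - real (d + Suc x) / T) * ?S (Suc x) + real (Suc x) / T * ?S x"
    unfolding sum.distrib sum_distrib_left[symmetric] by simp
  finally have "degree_law d B (Suc s) (Suc x) = real ((Suc x + d - 1) choose Suc x) *
      ((1 - real (d + Suc x) / T) * ?S (Suc x) + real (Suc x) / T * ?S x)"
    unfolding degree_law_def a_Suc by simp
  also have "\<dots> = (1 - real (d + Suc x) / T) * (real ((Suc x + d - 1) choose Suc x) * ?S (Suc x))
      + (real (Suc x) * real ((Suc x + d - 1) choose Suc x)) / T * ?S x"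
    by (simp only: distrib_left times_divide_eq_left times_divide_eq_right mult_ac)
  also have "\<dots> = (1 - real (d + Suc x) / T) * degree_law d B s (Suc x)
      + real (d + x) / T * degree_law d B s x"
    unfolding absorb' by (simp add: degree_law_def a_def)
  finally show ?thesis
    by (simp add: T_def)
qed

text \<open>Initial and boundary values determine \<open>p\<close> by induction on \<open>s\<close>,
  and \<open>degree_law\<close> obeys the same recurrence.\<close>

lemma degree_recurrence_solution:
  fixes p :: "nat \<Rightarrow> nat \<Rightarrow> real"
  assumes B: "B > 0" and d: "d \<ge> 1"
    and init: "\<And>c. p 0 c = (if c = d then 1 else 0)"
    and zero: "\<And>s. p s 0 = 0"
    and rec: "\<And>s c. p (Suc s) (Suc c) = (1 - real (Suc c) / (2 * (B + real s))) * p s (Suc c)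
      + real c / (2 * (B + real s)) * p s c"
  shows "p s (d + x) = degree_law d B s x"
proof -
  \<comment> \<open>Degrees below the initial one never acquire mass. For \<open>x = 0\<close> this
    removes the inflow from \<open>d - 1\<close> and leaves the recurrence of
    \<open>degree_law_Suc_0\<close>.\<close>
  have below: "p s c = 0" if "c < d" for s c
    using that
  proof (induction s arbitrary: c)
    case (Suc s)
    then show ?case
      by (cases c) (simp_all add: zero rec)
  qed (simp add: init)
  obtain d' where d': "d = Suc d'"
    using d by (cases d) auto
  show ?thesis
  proof (induction s arbitrary: x)
    case 0
    show ?case
      by (simp add: init degree_law_0)
  next
    case (Suc s)
    show ?case
    proof (cases x)
      case 0
      have "p (Suc s) d = (1 - real d / (2 * (B + real s))) * p s d"
        using rec[of s d'] below[of d' s] by (simp add: d')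
      then show ?thesis
        using Suc.IH[of 0] by (simp add: 0 degree_law_Suc_0[OF B])
    next
      case (Suc y)
      then show ?thesis
        using rec[of s "d + y"] Suc.IH[of y] Suc.IH[of "Suc y"] by (simp add: degree_law_Suc_Suc[OF B d])
    qed
  qed
qed

text \<open>Covers initial and later vertices alike: \<open>b\<close> is a time at which the degree
  of \<open>i\<close> is surely \<open>d\<close>, and time is counted from there. \<open>B\<close>
  is the quantity \<open>T\<close> of the recurrence at time \<open>b\<close>, so
  \<open>B + s\<close> is its value \<open>s\<close> steps later.\<close>

lemma prob_deg_eq_degree_law:
  fixes k j :: nat
  assumes k: "k \<ge> 2" and j: "j \<ge> k + 1"
    and b: "1 \<le> i" "i \<le> b" "j \<le> b" "b \<le> n" and d: "d \<ge> 1"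
    and init: "\<And>G. G \<in> set_pmf (graph_process k j b) \<Longrightarrow> deg G i = d"
    and B: "B = real j * (real j - 1) / (2 * real k) + real b - real j"
  shows "measure_pmf.prob (graph_process k j n) {G. deg G i = d + x} = degree_law d B (n - b) x"
proof -
  define p where "p s c = measure_pmf.prob (graph_process k j (b + s)) {G. deg G i = c}" for s c
  have "p (n - b) (d + x) = degree_law d B (n - b) x"
  proof (rule degree_recurrence_solution[OF _ d])
    have "real j * (real j - 1) / (2 * real k) > 0"
      using k j by simp
    then show "B > 0"
      using b(3) unfolding B by linarith
    show "p 0 c = (if c = d then 1 else 0)" for c
    proof -
      have "p 0 c = measure_pmf.prob (graph_process k j b) (if c = d then UNIV else {})"
        unfolding p_def add_0_right using init by (intro measure_pmf.finite_measure_eq_AE) (auto simp: AE_measure_pmf_iff)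
      then show ?thesis
        by simp
    qed
    show "p s 0 = 0" for s
      unfolding p_def using b by (intro prob_deg_0[OF k j]) auto
    show "p (Suc s) (Suc c) = (1 - real (Suc c) / (2 * (B + real s))) * p s (Suc c)
        + real c / (2 * (B + real s)) * p s c" for s c
      unfolding p_def add_Suc_right using b by (intro prob_deg_recurrence[OF k j]) (auto simp: B)
  qed
  then show ?thesis
    using b(4) by (simp add: p_def)
qed

theorem mainTheorem1:
  fixes k j :: nat and R :: real
  assumes "k \<ge> 2" and "j \<ge> k + 1"
    and "R = real j * (real j - 1) / (2 * real k)"
  shows
    "(\<forall>i n x. 1 \<le> i \<and> i \<le> j \<and> j \<le> n \<and> x \<le> n - j \<longrightarrow>
        measure_pmf.prob (graph_process k j n) {G. deg G i = j - 1 + x} =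
          real ((x + j - 2) choose x) *
          (\<Sum>u = 0..x. (-1) ^ u * real (x choose u) *
             (falling (real n - real j
                + ((real j - 1) * (real j - real k) - real k * real u) / (2 * real k) - 1) (n - j)
              / falling (real n - real j + R - 1) (n - j))))
     \<and>
     (\<forall>i n x. j < i \<and> i \<le> n \<and> x \<le> n - i \<longrightarrow>
        measure_pmf.prob (graph_process k j n) {G. deg G i = k + x} =
          real ((x + k - 1) choose x) *
          (\<Sum>u = 0..x. (-1) ^ u * real (x choose u) *
             (falling (real n - real j + R - (real u + real k) / 2 - 1) (n - i)
              / falling (real n - real j + R - 1) (n - i))))"
proof (intro conjI allI impI; elim conjE)
  note k = assms(1) and j = assms(2) and R = assms(3)
  fix i n x
  assume i: "1 \<le> i" "i \<le> j" and n: "j \<le> n"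
  \<comment> \<open>An initial vertex starts at time \<open>j\<close> with degree
    \<open>j - 1\<close>, so \<open>B\<close> is just \<open>R\<close>.\<close>
  have "measure_pmf.prob (graph_process k j n) {G. deg G i = (j - 1) + x} = degree_law (j - 1) R (n - j) x"
    using i n k j R by (intro prob_deg_eq_degree_law[OF k j]) (auto simp: deg_complete_ugraph)
  \<comment> \<open>Rests on \<open>(j - 1) * (j - k) / (2 * k) = R - (j - 1) / 2\<close>.\<close>
  moreover have "real n - real j + ((real j - 1) * (real j - real k) - real k * real u) / (2 * real k) - 1
      = R + real (n - j) - (real u + real (j - 1)) / 2 - 1" for u :: nat
    using k j n by (simp add: R of_nat_diff field_simps)
  moreover have "real n - real j + R - 1 = R + real (n - j) - 1"
    using n by (simp add: of_nat_diff)
  moreover have "x + j - 2 = x + (j - 1) - 1"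
    using k j by simp
  ultimately show "measure_pmf.prob (graph_process k j n) {G. deg G i = j - 1 + x} =
      real ((x + j - 2) choose x) *
      (\<Sum>u = 0..x. (-1) ^ u * real (x choose u) *
         (falling (real n - real j
            + ((real j - 1) * (real j - real k) - real k * real u) / (2 * real k) - 1) (n - j)
          / falling (real n - real j + R - 1) (n - j)))"
    by (simp only: degree_law_def)
next
  note k = assms(1) and j = assms(2) and R = assms(3)
  fix i n x
  assume i: "j < i" "i \<le> n"
  \<comment> \<open>A later vertex starts at its own time \<open>i\<close> with degree
    \<open>k\<close>; adding the remaining \<open>n - i\<close> steps to \<open>B\<close> gives
    \<open>n - j + R\<close>.\<close>
  define B where "B = R + real i - real j"
  have "measure_pmf.prob (graph_process k j n) {G. deg G i = k + x} = degree_law k B (n - i) x"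
    using i k j R by (intro prob_deg_eq_degree_law[OF k j]) (auto simp: B_def graph_process_deg_new[OF k j])
  moreover have "B + real (n - i) = real n - real j + R"
    using i by (simp add: B_def of_nat_diff)
  ultimately show "measure_pmf.prob (graph_process k j n) {G. deg G i = k + x} =
      real ((x + k - 1) choose x) *
      (\<Sum>u = 0..x. (-1) ^ u * real (x choose u) *
         (falling (real n - real j + R - (real u + real k) / 2 - 1) (n - i)
          / falling (real n - real j + R - 1) (n - i)))"
    by (simp add: degree_law_def)
qed

end
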